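(* Let $R,S\in\mathbb{Q}$ and $n,N\in\mathbb{N}$ with $S\neq 0$ and $0\le n\le N$. Set $s:=N-n$ and $Q:=S-R$. Then \[ {}_{N+s}F_{N+s-1}\!\left(\left[\tfrac{Q}{N},\tfrac{Q+1}{N},\dots,\tfrac{Q+N-1}{N},\ \tfrac{S}{s},\dots,\tfrac{S+s-1}{s}\right],\ \left[\tfrac{Q}{s},\dots,\tfrac{Q+s-1}{s},\ 1,\dots,1\right];\ N^N t\right) =\operatorname{Diag}\!\left(\frac{(1-x_1-\dots-x_n)^R}{(1-x_1-\dots-x_N)^S}\right). \] Here the list $\tfrac{S}{s},\dots,\tfrac{S+s-1}{s}$ has $s$ entries, the list $\tfrac{Q}{s},\dots,\tfrac{Q+s-1}{s}$ has $s$ entries, and the bottom row contains $N-1$ entries equal to $1$.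
   Context: All power series have coefficients in $\mathbb{Q}$ (or any field of characteristic zero). For $a\in\mathbb{Q}$ and a power series $L$ with zero constant term, $(1+L)^a:=\sum_{j\ge0}\binom{a}{j}L^j$, where $\binom{a}{j}=a(a-1)\cdots(a-j+1)/j!$. For $g=\sum g_{i_1,\dots,i_N}x_1^{i_1}\cdots x_N^{i_N}$, the diagonal is $\operatorname{Diag}(g):=\sum_{j\ge0}g_{j,\dots,j}t^j$. The generalized hypergeometric function is ${}_pF_q([a_1,\dots,a_p],[b_1,\dots,b_q];t):=\sum_{j\ge0}\frac{(a_1)_j\cdots(a_p)_j}{(b_1)_j\cdots(b_q)_j}\frac{t^j}{j!}$, with $(x)_j=x(x+1)\cdots(x+j-1)$, defined when $b_i+j\neq0$ for all $i$ and all $j\in\mathbb{N}$. *)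

theory Defs
  imports "HOL-Computational_Algebra.Formal_Power_Series" "HOL-Library.Poly_Mapping"
begin

text \<open>
  Formal power series with coefficients in \<open>'a\<close> in commuting variables indexed by \<open>'v\<close>.
  A monomial is its finitely supported exponent vector, so for infinite \<open>'v\<close> (such as \<^typ>\<open>nat\<close>)
  the power series ring in any finite set of the variables is a subring.
\<close>

typedef ('v, 'a) mfps = "UNIV :: (('v \<Rightarrow>\<^sub>0 nat) \<Rightarrow> 'a) set"
  morphisms mfps_nth Abs_mfps ..

declare Abs_mfps_inverse [OF UNIV_I, simp]

lemma mfps_eqI: "(\<And>m. mfps_nth f m = mfps_nth g m) \<Longrightarrow> f = g"
  by (rule mfps_nth_inject [THEN iffD1], rule ext)

lemma finite_monom_le:
  fixes m :: "'v \<Rightarrow>\<^sub>0 nat"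
  shows "finite {p. \<forall>k. Poly_Mapping.lookup p k \<le> Poly_Mapping.lookup m k}"
proof -
  define M where "M = Max (insert 0 (Poly_Mapping.lookup m ` Poly_Mapping.keys m))"
  have M: "Poly_Mapping.lookup m k \<le> M" if "k \<in> Poly_Mapping.keys m" for k
    unfolding M_def using that by (intro Max_ge) auto
  have "finite {f. \<forall>k. (k \<in> Poly_Mapping.keys m \<longrightarrow> f k \<in> {..M})
      \<and> (k \<notin> Poly_Mapping.keys m \<longrightarrow> f k = (0::nat))}"
    by (rule finite_set_of_finite_funs) auto
  moreover have "Poly_Mapping.lookup ` {p. \<forall>k. Poly_Mapping.lookup p k \<le> Poly_Mapping.lookup m k}
      \<subseteq> {f. \<forall>k. (k \<in> Poly_Mapping.keys m \<longrightarrow> f k \<in> {..M})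
        \<and> (k \<notin> Poly_Mapping.keys m \<longrightarrow> f k = 0)}"
  proof clarsimp
    fix p k assume p: "\<forall>k. Poly_Mapping.lookup p k \<le> Poly_Mapping.lookup m k"
    show "(k \<in> Poly_Mapping.keys m \<longrightarrow> Poly_Mapping.lookup p k \<le> M)
        \<and> (k \<notin> Poly_Mapping.keys m \<longrightarrow> Poly_Mapping.lookup p k = 0)"
      using p M[of k] by (metis in_keys_iff le_trans le_zero_eq)
  qed
  ultimately have "finite (Poly_Mapping.lookup ` {p. \<forall>k. Poly_Mapping.lookup p k \<le> Poly_Mapping.lookup m k})"
    by (rule rev_finite_subset)
  then show ?thesis
    by (rule finite_imageD) (simp add: inj_on_def Poly_Mapping.lookup_inject)
qed

definition monom_splits :: "('v \<Rightarrow>\<^sub>0 nat) \<Rightarrow> (('v \<Rightarrow>\<^sub>0 nat) \<times> ('v \<Rightarrow>\<^sub>0 nat)) set" where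
  "monom_splits m = {(p, q). p + q = m}"

lemma finite_monom_splits [simp]: "finite (monom_splits m)"
proof (rule finite_subset)
  let ?D = "{p. \<forall>k. Poly_Mapping.lookup p k \<le> Poly_Mapping.lookup m k}"
  show "monom_splits m \<subseteq> ?D \<times> ?D"
    by (auto simp: monom_splits_def lookup_add)
  show "finite (?D \<times> ?D)"
    by (intro finite_cartesian_product finite_monom_le)
qed

instantiation mfps :: (type, comm_ring_1) comm_ring_1
begin

definition zero_mfps :: "('a, 'b) mfps" where
  "0 = Abs_mfps (\<lambda>_. 0)"

definition one_mfps :: "('a, 'b) mfps" where
  "1 = Abs_mfps (\<lambda>m. if m = 0 then 1 else 0)"

definition plus_mfps :: "('a, 'b) mfps \<Rightarrow> ('a, 'b) mfps \<Rightarrow> ('a, 'b) mfps" where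
  "f + g = Abs_mfps (\<lambda>m. mfps_nth f m + mfps_nth g m)"

definition uminus_mfps :: "('a, 'b) mfps \<Rightarrow> ('a, 'b) mfps" where
  "- f = Abs_mfps (\<lambda>m. - mfps_nth f m)"

definition minus_mfps :: "('a, 'b) mfps \<Rightarrow> ('a, 'b) mfps \<Rightarrow> ('a, 'b) mfps" where
  "f - g = Abs_mfps (\<lambda>m. mfps_nth f m - mfps_nth g m)"

definition times_mfps :: "('a, 'b) mfps \<Rightarrow> ('a, 'b) mfps \<Rightarrow> ('a, 'b) mfps" where
  "f * g = Abs_mfps (\<lambda>m. \<Sum>(p, q)\<in>monom_splits m. mfps_nth f p * mfps_nth g q)"

instance
proof
  fix f g h :: "('a, 'b) mfps"
  note nth_defs = zero_mfps_def one_mfps_def plus_mfps_def uminus_mfps_def minus_mfps_def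
  show "f + g + h = f + (g + h)" "f + g = g + f" "0 + f = f" "- f + f = 0" "f - g = f + - g"
    by (auto intro!: mfps_eqI simp: nth_defs)
  show "(0::('a, 'b) mfps) \<noteq> 1"
    unfolding zero_mfps_def one_mfps_def Abs_mfps_inject[OF UNIV_I UNIV_I]
    by (metis zero_neq_one)
  show "(f + g) * h = f * h + g * h"
    by (auto intro!: mfps_eqI
        simp: plus_mfps_def times_mfps_def distrib_right case_prod_unfold sum.distrib)
  show "f * g = g * f"
  proof (rule mfps_eqI)
    fix m
    show "mfps_nth (f * g) m = mfps_nth (g * f) m"
      unfolding times_mfps_def Abs_mfps_inverse[OF UNIV_I]
      by (rule sum.reindex_bij_witness[of _ prod.swap prod.swap])
        (auto simp: monom_splits_def add.commute mult.commute)
  qed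
  show "1 * f = f"
  proof (rule mfps_eqI)
    fix m
    have "mfps_nth (1 * f) m =
        (\<Sum>(p, q)\<in>monom_splits m. (if p = 0 then 1 else 0) * mfps_nth f q)"
      by (simp add: times_mfps_def one_mfps_def)
    also have "\<dots> = (\<Sum>(p, q)\<in>{(0 :: 'a \<Rightarrow>\<^sub>0 nat, m)}. (if p = 0 then 1 else 0) * mfps_nth f q)"
    proof (rule sum.mono_neutral_right)
      show "{(0, m)} \<subseteq> monom_splits m" by (simp add: monom_splits_def)
      show "\<forall>z\<in>monom_splits m - {(0, m)}.
          (case z of (p, q) \<Rightarrow> (if p = 0 then 1 else 0) * mfps_nth f q) = 0"
        by (auto simp: monom_splits_def split: if_splits)
    qed simp
    finally show "mfps_nth (1 * f) m = mfps_nth f m" by simp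
  qed
  show "f * g * h = f * (g * h)"
  proof (rule mfps_eqI)
    fix m
    have "mfps_nth (f * g * h) m = (\<Sum>z\<in>monom_splits m. \<Sum>w\<in>monom_splits (fst z).
        mfps_nth f (fst w) * mfps_nth g (snd w) * mfps_nth h (snd z))"
      by (simp add: times_mfps_def case_prod_unfold sum_distrib_right)
    also have "\<dots> = (\<Sum>(z, w)\<in>(SIGMA z:monom_splits m. monom_splits (fst z)).
        mfps_nth f (fst w) * mfps_nth g (snd w) * mfps_nth h (snd z))"
      by (rule sum.Sigma) auto
    also have "\<dots> = (\<Sum>(z, w)\<in>(SIGMA z:monom_splits m. monom_splits (snd z)).
        mfps_nth f (fst z) * (mfps_nth g (fst w) * mfps_nth h (snd w)))"
      by (rule sum.reindex_bij_witness
          [of _ "\<lambda>(z, w). ((fst z + fst w, snd w), (fst z, fst w))"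
                "\<lambda>(z, w). ((fst w, snd w + snd z), (snd w, snd z))"])
        (auto simp: monom_splits_def add.assoc mult.assoc)
    also have "\<dots> = (\<Sum>z\<in>monom_splits m. \<Sum>w\<in>monom_splits (snd z).
        mfps_nth f (fst z) * (mfps_nth g (fst w) * mfps_nth h (snd w)))"
      by (rule sum.Sigma [symmetric]) auto
    also have "\<dots> = mfps_nth (f * (g * h)) m"
      by (simp add: times_mfps_def case_prod_unfold sum_distrib_left)
    finally show "mfps_nth (f * g * h) m = mfps_nth (f * (g * h)) m" .
  qed
qed

end

instantiation mfps :: (type, comm_ring_1) inverse
begin

definition inverse_mfps :: "('a, 'b) mfps \<Rightarrow> ('a, 'b) mfps" where
  "inverse (f :: ('a, 'b) mfps) = (if f dvd 1 then (THE g. f * g = 1) else 0)"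

definition divide_mfps :: "('a, 'b) mfps \<Rightarrow> ('a, 'b) mfps \<Rightarrow> ('a, 'b) mfps" where
  "(f :: ('a, 'b) mfps) div g = f * inverse g"

instance ..

end

lemma mfps_inverse_unique:
  fixes f g :: "('v, 'a::comm_ring_1) mfps"
  assumes "f * g = 1"
  shows "inverse f = g"
proof -
  have "f dvd 1" using assms by (metis dvdI)
  moreover have "(THE h. f * h = 1) = g"
  proof (rule the_equality)
    fix h assume "f * h = 1"
    have "h = (f * g) * h" by (simp add: assms)
    also have "\<dots> = (f * h) * g" by (simp only: ac_simps)
    finally show "h = g" by (simp add: \<open>f * h = 1\<close>)
  qed (fact assms)
  ultimately show ?thesis by (simp add: inverse_mfps_def)
qed

definition mfps_var :: "'v \<Rightarrow> ('v, 'a::comm_ring_1) mfps" where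
  "mfps_var i = Abs_mfps (\<lambda>m. if m = Poly_Mapping.single i 1 then 1 else 0)"

text \<open>
  \<open>mfps_powr (1 + L) a\<close> is the binomial series \<open>\<Sum>j. (a gchoose j) * L ^ j\<close>, meant for \<open>L\<close> with zero
  constant term. The sum is taken coefficientwise; each coefficient receives only finitely many
  nonzero contributions (lemma \<open>finite_mfps_powr_support\<close>).
\<close>

definition mfps_powr :: "('v, 'a::field_char_0) mfps \<Rightarrow> 'a \<Rightarrow> ('v, 'a) mfps" where
  "mfps_powr f a = Abs_mfps (\<lambda>m. Sum_any (\<lambda>j. (a gchoose j) * mfps_nth ((f - 1) ^ j) m))"

lemma mfps_nth_power_eq_0:
  fixes L :: "('v, 'a::comm_ring_1) mfps"
  assumes "mfps_nth L 0 = 0" "sum (Poly_Mapping.lookup m) (Poly_Mapping.keys m) < j"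
  shows "mfps_nth (L ^ j) m = 0"
  using assms(2)
proof (induction j arbitrary: m)
  case 0
  then show ?case by simp
next
  case (Suc j)
  have "mfps_nth L p * mfps_nth (L ^ j) q = 0" if "p + q = m" for p q
  proof (cases "p = 0")
    case True
    then show ?thesis using assms(1) by simp
  next
    case False
    have sup: "sum (Poly_Mapping.lookup r) (Poly_Mapping.keys r)
        = sum (Poly_Mapping.lookup r) (Poly_Mapping.keys p \<union> Poly_Mapping.keys q)"
      if "Poly_Mapping.keys r \<subseteq> Poly_Mapping.keys p \<union> Poly_Mapping.keys q" for r :: "'v \<Rightarrow>\<^sub>0 nat"
      using that by (intro sum.mono_neutral_left) (auto simp: in_keys_iff)
    have "sum (Poly_Mapping.lookup m) (Poly_Mapping.keys m)
        = sum (Poly_Mapping.lookup p) (Poly_Mapping.keys p)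
        + sum (Poly_Mapping.lookup q) (Poly_Mapping.keys q)"
    proof -
      have "sum (Poly_Mapping.lookup m) (Poly_Mapping.keys m)
        = sum (Poly_Mapping.lookup m) (Poly_Mapping.keys p \<union> Poly_Mapping.keys q)"
        using Poly_Mapping.keys_add[of p q] \<open>p + q = m\<close> by (intro sup) simp
      also have "\<dots> = sum (Poly_Mapping.lookup p) (Poly_Mapping.keys p \<union> Poly_Mapping.keys q)
          + sum (Poly_Mapping.lookup q) (Poly_Mapping.keys p \<union> Poly_Mapping.keys q)"
        unfolding \<open>p + q = m\<close> [symmetric] by (simp add: lookup_add sum.distrib)
      also have "\<dots> = sum (Poly_Mapping.lookup p) (Poly_Mapping.keys p)
        + sum (Poly_Mapping.lookup q) (Poly_Mapping.keys q)"
        using sup[of p] sup[of q] by simp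
      finally show ?thesis .
    qed
    moreover have "sum (Poly_Mapping.lookup p) (Poly_Mapping.keys p) > 0"
    proof -
      obtain k where "k \<in> Poly_Mapping.keys p" using False by (metis ex_in_conv keys_eq_empty)
      then show ?thesis by (intro sum_pos2[of _ k]) (auto simp: in_keys_iff)
    qed
    ultimately have "sum (Poly_Mapping.lookup q) (Poly_Mapping.keys q) < j"
      using Suc.prems by linarith
    then show ?thesis using Suc.IH by simp
  qed
  then have "(\<Sum>(p, q)\<in>monom_splits m. mfps_nth L p * mfps_nth (L ^ j) q) = 0"
    by (intro sum.neutral) (auto simp only: monom_splits_def)
  then show ?case
    by (simp add: times_mfps_def)
qed

lemma finite_mfps_powr_support:
  fixes f :: "('v, 'a::field_char_0) mfps"
  assumes "mfps_nth f 0 = 1"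
  shows "finite {j. (a gchoose j) * mfps_nth ((f - 1) ^ j) m \<noteq> 0}"
proof (rule finite_subset)
  have "mfps_nth (f - 1) 0 = 0" using assms by (simp add: minus_mfps_def one_mfps_def)
  then have "mfps_nth ((f - 1) ^ j) m = 0"
    if "sum (Poly_Mapping.lookup m) (Poly_Mapping.keys m) < j" for j
    using that by (rule mfps_nth_power_eq_0)
  then show "{j. (a gchoose j) * mfps_nth ((f - 1) ^ j) m \<noteq> 0}
      \<subseteq> {..sum (Poly_Mapping.lookup m) (Poly_Mapping.keys m)}"
    by (metis (mono_tags, lifting) atMost_iff leI mem_Collect_eq mult_zero_right subsetI)
qed simp

text \<open>The \<open>N\<close> variables are numbered \<open>1, \<dots>, N\<close>; the variable with index \<open>0\<close> is unused.\<close>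

definition mfps_diag :: "nat \<Rightarrow> (nat, 'a::comm_ring_1) mfps \<Rightarrow> 'a fps" where
  "mfps_diag N g = Abs_fps (\<lambda>j. mfps_nth g (\<Sum>i=1..N. Poly_Mapping.single i j))"

text \<open>The list \<open>a/m, (a+1)/m, \<dots>, (a+m-1)/m\<close>, empty for \<open>m = 0\<close>.\<close>

definition arith_params :: "'a::field_char_0 \<Rightarrow> nat \<Rightarrow> 'a list" where
  "arith_params a m = map (\<lambda>k. (a + of_nat k) / of_nat m) [0..<m]"

text \<open>
  The condition on the lower parameters under which the hypergeometric series is defined;
  \<^const>\<open>fps_hypergeo\<close> itself is total because division by zero is.
\<close>

definition hypergeo_defined :: "'a::field_char_0 list \<Rightarrow> bool" where
  "hypergeo_defined bs \<longleftrightarrow> (\<forall>b\<in>set bs. \<forall>j::nat. b + of_nat j \<noteq> 0)"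

end

theory Submission
  imports Defs
begin

text \<open>
  Write \<open>|m|\<close> for the degree of an exponent vector \<open>m\<close> and \<open>m!\<close> for the product of the factorials
  of its entries. By the multinomial theorem the coefficient of \<open>x^m\<close> in
  \<open>(1 - \<Sum>i\<in>A. x i)^a\<close> is \<open>(-a)_|m| / m!\<close> if \<open>m\<close> is supported in \<open>A\<close>, and \<open>0\<close> otherwise.
  Comparing coefficients in \<open>L^k * L^l = L^(k + l)\<close> for \<open>L = \<Sum>i\<in>A. x i\<close> reduces the convolution of
  two such families to the Chu--Vandermonde identity. If \<open>m = u + v\<close> with \<open>u\<close> supported in \<open>A\<close> and
  \<open>v\<close> outside, the splittings of \<open>m\<close> whose first part is supported in \<open>A\<close> are those of \<open>u\<close>, shifted
  by \<open>v\<close>; with \<open>(S)_(|v| + r) = (S)_|v| * (S + |v|)_r\<close> the same identity gives the coefficient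
  \<open>(S)_|v| * (S - R + |v|)_|u| / m!\<close> of the quotient. On the diagonal this is
  \<open>(S)_(s j) * (Q)_(N j) / ((Q)_(s j) * j!^N)\<close>, which is the hypergeometric coefficient by
  Gauss multiplication for Pochhammer symbols.
\<close>

section \<open>Degree and factorial of an exponent vector\<close>

definition monom_degree :: "('v \<Rightarrow>\<^sub>0 nat) \<Rightarrow> nat" where
  "monom_degree m = (\<Sum>k\<in>Poly_Mapping.keys m. Poly_Mapping.lookup m k)"

text \<open>The values lie in the coefficient field so that they can serve directly as denominators
  of coefficients.\<close>

definition monom_fact :: "('v \<Rightarrow>\<^sub>0 nat) \<Rightarrow> 'a::field_char_0" where
  "monom_fact m = (\<Prod>k\<in>Poly_Mapping.keys m. fact (Poly_Mapping.lookup m k))"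

lemma monom_degree_superset:
  assumes "finite A" "Poly_Mapping.keys m \<subseteq> A"
  shows "monom_degree m = (\<Sum>k\<in>A. Poly_Mapping.lookup m k)"
  unfolding monom_degree_def using assms
  by (intro sum.mono_neutral_left) (auto simp: in_keys_iff)

lemma monom_fact_superset:
  assumes "finite A" "Poly_Mapping.keys m \<subseteq> A"
  shows "monom_fact m = (\<Prod>k\<in>A. fact (Poly_Mapping.lookup m k))"
  unfolding monom_fact_def using assms
  by (intro prod.mono_neutral_left) (auto simp: in_keys_iff)

lemma monom_fact_nonzero [simp]: "monom_fact m \<noteq> 0"
  by (simp add: monom_fact_def)

lemma monom_fact_0 [simp]: "monom_fact 0 = 1"
  by (simp add: monom_fact_def)

lemma monom_degree_eq_0_iff [simp]: "monom_degree m = 0 \<longleftrightarrow> m = 0"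
proof
  assume "monom_degree m = 0"
  then have "\<forall>k\<in>Poly_Mapping.keys m. Poly_Mapping.lookup m k = 0"
    by (simp add: monom_degree_def)
  then show "m = 0"
    by (intro poly_mapping_eqI) (auto simp: in_keys_iff)
qed (simp add: monom_degree_def)

text \<open>Natural exponents cannot cancel, so a support condition on a sum splits into conditions
  on its summands.\<close>

lemma keys_add_nat:
  fixes p q :: "'v \<Rightarrow>\<^sub>0 nat"
  shows "Poly_Mapping.keys (p + q) = Poly_Mapping.keys p \<union> Poly_Mapping.keys q"
  by (auto simp: in_keys_iff lookup_add)

lemma monom_degree_add: "monom_degree (p + q) = monom_degree p + monom_degree q"
  by (simp add: monom_degree_superset[of "Poly_Mapping.keys p \<union> Poly_Mapping.keys q"]
      keys_add_nat lookup_add sum.distrib)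

lemma monom_degree_single [simp]: "monom_degree (Poly_Mapping.single i k) = k"
  by (simp add: monom_degree_def)

lemma monom_fact_add_disjoint:
  assumes "Poly_Mapping.keys p \<inter> Poly_Mapping.keys q = {}"
  shows "monom_fact (p + q) = monom_fact p * monom_fact q"
proof -
  have "Poly_Mapping.lookup q k = 0" if "k \<in> Poly_Mapping.keys p" for k
    using assms that by (auto simp: in_keys_iff)
  moreover have "Poly_Mapping.lookup p k = 0" if "k \<in> Poly_Mapping.keys q" for k
    using assms that by (auto simp: in_keys_iff)
  ultimately show ?thesis
    using assms by (simp add: monom_fact_def keys_add_nat prod.union_disjoint lookup_add)
qed

text \<open>The recursion for \<open>m!\<close> that drives the induction for powers of a linear
  form.\<close>

lemma monom_fact_single_add:
  "monom_fact (Poly_Mapping.single i 1 + q) = of_nat (Suc (Poly_Mapping.lookup q i)) * monom_fact q"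
proof -
  let ?A = "insert i (Poly_Mapping.keys q)"
  have "monom_fact (Poly_Mapping.single i 1 + q)
      = (\<Prod>k\<in>?A. fact (Poly_Mapping.lookup (Poly_Mapping.single i 1 + q) k))"
    by (rule monom_fact_superset) (auto simp: keys_add_nat)
  also have "\<dots> = fact (Suc (Poly_Mapping.lookup q i))
      * (\<Prod>k\<in>?A - {i}. fact (Poly_Mapping.lookup q k))"
    by (subst prod.remove[of _ i])
      (auto simp: lookup_add lookup_single when_def intro!: prod.cong split: if_splits)
  also have "\<dots> = of_nat (Suc (Poly_Mapping.lookup q i)) * (\<Prod>k\<in>?A. fact (Poly_Mapping.lookup q k))"
    by (subst prod.remove[of ?A i]) (auto simp: mult.assoc)
  also have "(\<Prod>k\<in>?A. fact (Poly_Mapping.lookup q k)) = monom_fact q"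
    by (rule monom_fact_superset[symmetric]) auto
  finally show ?thesis .
qed

section \<open>Binomial series of linear forms\<close>

lemma mfps_nth_times: "mfps_nth (f * g) m = (\<Sum>(p, q)\<in>monom_splits m. mfps_nth f p * mfps_nth g q)"
  by (simp add: times_mfps_def)

lemma mfps_nth_1: "mfps_nth 1 m = (if m = 0 then 1 else 0)"
  by (simp add: one_mfps_def)

lemma mfps_nth_uminus [simp]: "mfps_nth (- f) m = - mfps_nth f m"
  by (simp add: uminus_mfps_def)

lemma mfps_nth_sum: "mfps_nth (\<Sum>i\<in>A. f i) m = (\<Sum>i\<in>A. mfps_nth (f i) m)"
  by (induction A rule: infinite_finite_induct) (simp_all add: zero_mfps_def plus_mfps_def)

text \<open>Only the splitting whose first part is the unit vector of \<open>i\<close> contributes.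
  The case distinction matters: exponent subtraction truncates, so for a monomial without
  \<open>i\<close> the difference would be \<open>m\<close> itself.\<close>

lemma mfps_nth_var_times:
  "mfps_nth (mfps_var i * g) m =
    (if Poly_Mapping.lookup m i = 0 then 0 else mfps_nth g (m - Poly_Mapping.single i 1))"
proof -
  let ?e = "Poly_Mapping.single i (1::nat)"
  have "mfps_nth (mfps_var i * g) m
      = (\<Sum>(p, q)\<in>monom_splits m. if p = ?e then mfps_nth g q else 0)"
    by (auto simp: mfps_nth_times mfps_var_def intro!: sum.cong)
  also have "\<dots> = (\<Sum>(p, q)\<in>{(p, q). p = ?e \<and> p + q = m}. mfps_nth g q)"
    by (rule sum.mono_neutral_cong_right, simp) (auto simp: monom_splits_def split: if_splits)
  also have "{(p, q). p = ?e \<and> p + q = m}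
      = (if Poly_Mapping.lookup m i = 0 then {} else {(?e, m - ?e)})"
  proof (cases "Poly_Mapping.lookup m i = 0")
    case True
    then show ?thesis by (auto simp: lookup_add)
  next
    case False
    then have "?e + (m - ?e) = m"
      by (intro poly_mapping_eqI) (auto simp: lookup_add lookup_minus lookup_single when_def)
    with False show ?thesis by auto
  qed
  finally show ?thesis by simp
qed

text \<open>The multinomial theorem, by induction on \<open>k\<close>: when one factor is split off,
  the variable \<open>i\<close> contributes \<open>m_i * k! / m!\<close>, and the exponents
  \<open>m_i\<close> add up to \<open>k + 1\<close>.\<close>

lemma mfps_nth_power_linear_form:
  fixes m :: "'v \<Rightarrow>\<^sub>0 nat"
  assumes "finite A"
  shows "mfps_nth ((\<Sum>i\<in>A. mfps_var i :: ('v, 'a::field_char_0) mfps) ^ k) m =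
    (if Poly_Mapping.keys m \<subseteq> A \<and> monom_degree m = k then fact k / monom_fact m else 0)"
proof (induction k arbitrary: m)
  case 0
  then show ?case by (auto simp: mfps_nth_1)
next
  case (Suc k)
  let ?L = "\<Sum>i\<in>A. mfps_var i :: ('v, 'a) mfps"
  let ?P = "Poly_Mapping.keys m \<subseteq> A \<and> monom_degree m = Suc k"
  have summand: "mfps_nth (mfps_var i * ?L ^ k) m =
      (if ?P then of_nat (Poly_Mapping.lookup m i) * (fact k / monom_fact m) else 0)"
    if "i \<in> A" for i
  proof (cases "Poly_Mapping.lookup m i = 0")
    case True
    then show ?thesis by (simp add: mfps_nth_var_times)
  next
    case False
    define q where "q = m - Poly_Mapping.single i 1"
    have m: "m = Poly_Mapping.single i 1 + q"
      using False unfolding q_def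
      by (intro poly_mapping_eqI) (auto simp: lookup_add lookup_minus lookup_single when_def)
    have iff: "?P \<longleftrightarrow> Poly_Mapping.keys q \<subseteq> A \<and> monom_degree q = k"
      using that by (auto simp: m keys_add_nat monom_degree_add)
    have "mfps_nth (mfps_var i * ?L ^ k) m = mfps_nth (?L ^ k) q"
      using False by (simp add: mfps_nth_var_times q_def)
    also have "\<dots> = (if ?P then fact k / monom_fact q else 0)"
      by (simp only: Suc.IH iff)
    also have "fact k / monom_fact q
        = (of_nat (Poly_Mapping.lookup m i) * (fact k / monom_fact m) :: 'a)"
      unfolding m monom_fact_single_add
      by (simp add: lookup_add divide_simps del: of_nat_Suc)
    finally show ?thesis .
  qed
  have "mfps_nth (?L ^ Suc k) m = (\<Sum>i\<in>A. mfps_nth (mfps_var i * ?L ^ k) m)"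
    by (simp add: sum_distrib_right mfps_nth_sum)
  also have "\<dots> = (if ?P then fact (Suc k) / monom_fact m else 0)"
  proof (cases ?P)
    case True
    then have "(\<Sum>i\<in>A. mfps_nth (mfps_var i * ?L ^ k) m)
        = of_nat (\<Sum>i\<in>A. Poly_Mapping.lookup m i) * (fact k / monom_fact m)"
      unfolding of_nat_sum sum_distrib_right by (intro sum.cong refl) (simp add: summand)
    moreover have "(\<Sum>i\<in>A. Poly_Mapping.lookup m i) = Suc k"
      using True monom_degree_superset[OF assms, of m] by simp
    ultimately show ?thesis using True by simp
  next
    case False
    then show ?thesis by (auto simp: summand intro!: sum.neutral)
  qed
  finally show ?case .
qed

text \<open>Powers of a linear form are homogeneous, so only \<open>j = |m|\<close> survives in the
  binomial series. The sign in \<open>(a gchoose j) = (-1)^j * (-a)_j / j!\<close> cancels that of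
  \<open>(-L)^j\<close>, and \<open>j!\<close> cancels the multinomial numerator.\<close>

lemma mfps_nth_powr_linear_form:
  fixes a :: "'a::field_char_0"
  assumes "finite A"
  shows "mfps_nth (mfps_powr (1 - (\<Sum>i\<in>A. mfps_var i)) a) m =
    (if Poly_Mapping.keys m \<subseteq> A then pochhammer (- a) (monom_degree m) / monom_fact m else 0)"
proof -
  let ?L = "\<Sum>i\<in>A. mfps_var i :: (_, 'a) mfps"
  let ?c = "if Poly_Mapping.keys m \<subseteq> A then pochhammer (- a) (monom_degree m) / monom_fact m else 0"
  have "(a gchoose j) * mfps_nth ((1 - ?L - 1) ^ j) m = (if j = monom_degree m then ?c else 0)" for j
  proof -
    have "mfps_nth ((1 - ?L - 1) ^ j) m = (-1) ^ j * mfps_nth (?L ^ j) m"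
      by (simp add: power_minus[of ?L] minus_one_power_iff)
    then show ?thesis
      by (auto simp: mfps_nth_power_linear_form[OF assms] gbinomial_pochhammer
          simp flip: power_mult_distrib)
  qed
  then have "mfps_nth (mfps_powr (1 - ?L) a) m
      = Sum_any (\<lambda>j. if j = monom_degree m then ?c else 0)"
    by (simp add: mfps_powr_def)
  also have "\<dots> = ?c"
    by (subst Sum_any.expand_superset[of "{monom_degree m}"]) auto
  finally show ?thesis .
qed

section \<open>Chu-Vandermonde over the splittings of an exponent vector\<close>

lemma sum_monom_splits_degree:
  assumes "k \<le> monom_degree m"
  shows "(\<Sum>(p, q)\<in>{(p, q)\<in>monom_splits m. monom_degree p = k}. 1 / (monom_fact p * monom_fact q)) =
    (of_nat (monom_degree m choose k) / monom_fact m :: 'a::field_char_0)"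
proof -
  define l where "l = monom_degree m - k"
  have deg: "monom_degree m = k + l" using assms by (simp add: l_def)
  let ?K = "Poly_Mapping.keys m"
  \<comment> \<open>With exactly the variables of \<open>m\<close>, every support condition on the
    parts of a splitting holds.\<close>
  let ?L = "\<Sum>i\<in>?K. mfps_var i :: (_, 'a) mfps"
  let ?T = "{(p, q)\<in>monom_splits m. monom_degree p = k}"
  have "fact (k + l) / monom_fact m = mfps_nth (?L ^ k * ?L ^ l) m"
    by (simp add: mfps_nth_power_linear_form deg flip: power_add)
  also have "\<dots> = (\<Sum>(p, q)\<in>?T. fact k * fact l * (1 / (monom_fact p * monom_fact q)))"
    unfolding mfps_nth_times
    by (rule sum.mono_neutral_cong_right, simp)
      (use deg in \<open>auto simp: monom_splits_def mfps_nth_power_linear_form keys_add_nat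
        monom_degree_add split: if_splits\<close>)
  also have "\<dots> = fact k * fact l * (\<Sum>(p, q)\<in>?T. 1 / (monom_fact p * monom_fact q))"
    by (simp add: sum_distrib_left case_prod_unfold)
  finally show ?thesis
    using deg by (simp add: binomial_fact field_simps)
qed

text \<open>Among the splittings with fixed \<open>|p| = k\<close> the Pochhammer factors are
  constant, so the sum collapses to the one-variable Chu-Vandermonde identity.\<close>

lemma pochhammer_monom_Vandermonde:
  fixes a b :: "'a::field_char_0"
  shows "(\<Sum>(p, q)\<in>monom_splits m. pochhammer a (monom_degree p) / monom_fact p *
      (pochhammer b (monom_degree q) / monom_fact q)) =
    pochhammer (a + b) (monom_degree m) / monom_fact m"
proof -
  let ?d = "monom_degree m"
  let ?f = "\<lambda>(p, q). pochhammer a (monom_degree p) / monom_fact p *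
      (pochhammer b (monom_degree q) / monom_fact q)"
  let ?T = "\<lambda>k. {(p, q)\<in>monom_splits m. monom_degree p = k}"
  have "(\<Sum>z\<in>monom_splits m. ?f z)
      = (\<Sum>k\<le>?d. \<Sum>z\<in>{z\<in>monom_splits m. monom_degree (fst z) = k}. ?f z)"
    by (rule sum.group[symmetric], simp) (auto simp: monom_splits_def monom_degree_add)
  also have "\<dots> = (\<Sum>k\<le>?d. pochhammer a k * pochhammer b (?d - k) *
      (\<Sum>(p, q)\<in>?T k. 1 / (monom_fact p * monom_fact q)))"
    unfolding sum_distrib_left
    by (intro sum.cong) (auto simp: monom_splits_def monom_degree_add)
  also have "\<dots> = (\<Sum>k\<le>?d. of_nat (?d choose k) * pochhammer a k * pochhammer b (?d - k)) / monom_fact m"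
    by (simp add: sum_monom_splits_degree sum_divide_distrib mult_ac)
  finally show ?thesis
    by (simp add: pochhammer_binomial_sum)
qed

section \<open>Inverses and quotients of binomial series\<close>

text \<open>The two parameters are opposite, so Vandermonde leaves \<open>(0)_|m|\<close>, which
  vanishes unless \<open>m = 0\<close>.\<close>

lemma inverse_mfps_powr_linear_form:
  fixes a :: "'a::field_char_0"
  assumes "finite A"
  shows "inverse (mfps_powr (1 - (\<Sum>i\<in>A. mfps_var i)) a) =
    mfps_powr (1 - (\<Sum>i\<in>A. mfps_var i :: ('v, 'a) mfps)) (- a)"
proof (rule mfps_inverse_unique, rule mfps_eqI)
  fix m :: "'v \<Rightarrow>\<^sub>0 nat"
  let ?f = "\<lambda>a. mfps_powr (1 - (\<Sum>i\<in>A. mfps_var i :: ('v, 'a) mfps)) a"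
  show "mfps_nth (?f a * ?f (- a)) m = mfps_nth 1 m"
  proof (cases "Poly_Mapping.keys m \<subseteq> A")
    case True
    then have "mfps_nth (?f a * ?f (- a)) m =
        (\<Sum>(p, q)\<in>monom_splits m. pochhammer (- a) (monom_degree p) / monom_fact p *
          (pochhammer a (monom_degree q) / monom_fact q))"
      unfolding mfps_nth_times
      by (intro sum.cong)
        (auto simp: monom_splits_def mfps_nth_powr_linear_form[OF assms] keys_add_nat)
    also have "\<dots> = mfps_nth 1 m"
      by (subst pochhammer_monom_Vandermonde) (simp add: pochhammer_0_left mfps_nth_1)
    finally show ?thesis .
  next
    case False
    \<comment> \<open>In every splitting some part leaves \<open>A\<close>; also \<open>m\<close> is
      nonzero, so its coefficient in \<open>1\<close> vanishes too.\<close>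
    then have "mfps_nth (?f a * ?f (- a)) m = 0"
      unfolding mfps_nth_times
      by (intro sum.neutral)
        (auto simp: monom_splits_def mfps_nth_powr_linear_form[OF assms] keys_add_nat)
    with False show ?thesis by (auto simp: mfps_nth_1)
  qed
qed

lemma mfps_nth_powr_quotient:
  fixes R S :: "'a::field_char_0"
  assumes "finite B" "A \<subseteq> B"
    and "Poly_Mapping.keys u \<subseteq> A" "Poly_Mapping.keys v \<subseteq> B - A"
  shows "mfps_nth (mfps_powr (1 - (\<Sum>i\<in>A. mfps_var i)) R / mfps_powr (1 - (\<Sum>i\<in>B. mfps_var i)) S) (u + v)
    = pochhammer S (monom_degree v) * pochhammer (S - R + of_nat (monom_degree v)) (monom_degree u)
      / (monom_fact u * monom_fact v)"
proof -
  have "finite A" using assms finite_subset by blast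
  let ?f = "mfps_powr (1 - (\<Sum>i\<in>A. mfps_var i)) R"
  let ?g = "mfps_powr (1 - (\<Sum>i\<in>B. mfps_var i)) (- S)"
  let ?d = "monom_degree v"
  let ?c = "pochhammer S ?d / monom_fact v"
  have "mfps_nth (?f * ?g) (u + v)
      = (\<Sum>(p, q)\<in>{(p, q)\<in>monom_splits (u + v). Poly_Mapping.keys p \<subseteq> A}.
          mfps_nth ?f p * mfps_nth ?g q)"
    unfolding mfps_nth_times
    by (rule sum.mono_neutral_right)
      (auto simp: mfps_nth_powr_linear_form[OF \<open>finite A\<close>] split: if_splits)
  also have "\<dots> = (\<Sum>(p, q)\<in>monom_splits u. mfps_nth ?f p * mfps_nth ?g (q + v))"
  proof -
    \<comment> \<open>Truncated subtraction of \<open>v\<close> is exact here: \<open>p\<close> has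
      no variable of \<open>v\<close>, so all of \<open>v\<close> sits inside
      \<open>q\<close>.\<close>
    have cancel: "q - v + v = q" if "p + q = u + v" "Poly_Mapping.keys p \<subseteq> A" for p q
    proof (rule poly_mapping_eqI)
      fix k
      show "Poly_Mapping.lookup (q - v + v) k = Poly_Mapping.lookup q k"
      proof (cases "k \<in> Poly_Mapping.keys v")
        case True
        then have "k \<notin> Poly_Mapping.keys p" using that assms by auto
        then have "Poly_Mapping.lookup q k = Poly_Mapping.lookup u k + Poly_Mapping.lookup v k"
          using arg_cong[OF that(1), of "\<lambda>m. Poly_Mapping.lookup m k"]
          by (simp add: lookup_add in_keys_iff)
        then show ?thesis by (simp add: lookup_add lookup_minus)
      qed (simp add: lookup_add lookup_minus in_keys_iff)
    qed
    have cancel': "p + (q - v) = u" if "p + q = u + v" "Poly_Mapping.keys p \<subseteq> A" for p q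
      using cancel[OF that] that(1) by (metis add.assoc add_right_cancel)
    have "Poly_Mapping.keys p \<subseteq> A" if "p + q = u" for p q
      using that assms(3) by (auto simp: keys_add_nat)
    then show ?thesis
      by (intro sum.reindex_bij_witness[of _ "\<lambda>(p, q). (p, q + v)" "\<lambda>(p, q). (p, q - v)"])
        (auto simp: monom_splits_def cancel cancel' simp flip: add.assoc)
  qed
  also have "\<dots> = (\<Sum>(p, q)\<in>monom_splits u. ?c * (pochhammer (- R) (monom_degree p) / monom_fact p *
      (pochhammer (S + of_nat ?d) (monom_degree q) / monom_fact q)))"
  proof (intro sum.cong refl, clarify)
    fix p q assume "(p, q) \<in> monom_splits u"
    then have keys: "Poly_Mapping.keys p \<subseteq> A" "Poly_Mapping.keys q \<subseteq> A"
      using assms by (auto simp: monom_splits_def keys_add_nat)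
    have "monom_fact (q + v) = monom_fact q * (monom_fact v :: 'a)"
      using keys assms by (intro monom_fact_add_disjoint) auto
    moreover have "pochhammer S (monom_degree (q + v))
        = pochhammer S ?d * pochhammer (S + of_nat ?d) (monom_degree q)"
      by (simp add: monom_degree_add add.commute[of "monom_degree q"] pochhammer_product')
    moreover have "Poly_Mapping.keys (q + v) \<subseteq> B"
      using keys assms by (auto simp: keys_add_nat)
    ultimately show "mfps_nth ?f p * mfps_nth ?g (q + v)
        = ?c * (pochhammer (- R) (monom_degree p) / monom_fact p *
          (pochhammer (S + of_nat ?d) (monom_degree q) / monom_fact q))"
      using keys by (simp add: mfps_nth_powr_linear_form \<open>finite A\<close> \<open>finite B\<close> mult_ac)
  qed
  also have "\<dots> = ?c * (pochhammer (- R + (S + of_nat ?d)) (monom_degree u) / monom_fact u)"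
    by (simp only: pochhammer_monom_Vandermonde[symmetric] sum_distrib_left case_prod_unfold)
  finally show ?thesis
    by (simp add: divide_mfps_def inverse_mfps_powr_linear_form[OF \<open>finite B\<close>] algebra_simps)
qed

section \<open>Hypergeometric coefficients\<close>

text \<open>\<open>fps_hypergeo\<close> accumulates its Pochhammer products with
  \<open>foldl\<close>; a general start value makes the induction go through.\<close>

lemma foldl_mult_eq_prod_list:
  fixes c :: "'a::comm_monoid_mult"
  shows "foldl (\<lambda>r x. r * f x) c xs = c * prod_list (map f xs)"
  by (induction xs arbitrary: c) (simp_all add: mult.assoc)

lemma prod_list_pochhammer_arith_params:
  fixes a :: "'a::field_char_0"
  shows "prod_list (map (\<lambda>x. pochhammer x j) (arith_params a m)) = pochhammer a (m * j) / of_nat m ^ (m * j)"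
proof -
  have "prod_list (map (\<lambda>x. pochhammer x j) (arith_params a m))
      = (\<Prod>k<m. pochhammer ((a + of_nat k) / of_nat m) j)"
    by (simp add: arith_params_def o_def prod.distinct_set_conv_list[symmetric] atLeast0LessThan)
  also have "\<dots> = pochhammer a (m * j) / of_nat m ^ (m * j)"
  proof (cases "m = 0")
    case False
    show ?thesis
    proof (induction j)
      case (Suc j)
      \<comment> \<open>Passing from \<open>j\<close> to \<open>j + 1\<close> adds one factor to
        each of the \<open>m\<close> symbols; together these are the \<open>m\<close> factors that
        follow those of \<open>(a)_(m j)\<close>, each divided by \<open>m\<close>.\<close>
      have "(\<Prod>k<m. (a + of_nat k) / of_nat m + of_nat j)
          = (\<Prod>k<m. (a + of_nat (m * j) + of_nat k) / of_nat m)"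
        using False by (intro prod.cong refl) (simp add: field_simps)
      also have "\<dots> = pochhammer (a + of_nat (m * j)) m / of_nat m ^ m"
        by (simp add: prod_dividef pochhammer_prod atLeast0LessThan)
      finally have "(\<Prod>k<m. pochhammer ((a + of_nat k) / of_nat m) (Suc j))
          = pochhammer a (m * j) / of_nat m ^ (m * j)
            * (pochhammer (a + of_nat (m * j)) m / of_nat m ^ m)"
        by (simp add: pochhammer_Suc prod.distrib Suc.IH)
      moreover have "m * Suc j = m * j + m" by simp
      ultimately show ?case
        by (simp only: pochhammer_product' power_add times_divide_times_eq)
    qed simp
  qed simp
  finally show ?thesis .
qed

text \<open>By Gauss multiplication, \<open>(a)_(m j) = 0\<close> would force
  \<open>(x)_j = 0\<close> for some \<open>x\<close> in the list, making \<open>x\<close> a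
  nonpositive integer.\<close>

lemma pochhammer_nonzero_if_hypergeo_defined:
  assumes "hypergeo_defined (arith_params a m @ bs)"
  shows "pochhammer a (m * j) \<noteq> 0"
proof -
  have "pochhammer x j \<noteq> 0" if "x \<in> set (arith_params a m)" for x
    using assms that unfolding hypergeo_defined_def pochhammer_eq_0_iff
    by (metis UnI1 add.left_inverse set_append)
  then have "prod_list (map (\<lambda>x. pochhammer x j) (arith_params a m)) \<noteq> 0"
    by (auto simp: prod_list_zero_iff)
  then show ?thesis
    by (auto simp: prod_list_pochhammer_arith_params)
qed

text \<open>The powers of \<open>s\<close> from the upper and lower Gauss products cancel, the power
  of \<open>N\<close> cancels the scaling \<open>N ^ N\<close> of the argument, and the
  \<open>N - 1\<close> ones together with the built-in \<open>j!\<close> give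
  \<open>j!^N\<close>.\<close>

lemma fps_hypergeo_arith_params_nth:
  fixes Q S :: "'a::field_char_0"
  assumes "1 \<le> N"
  shows "fps_nth (fps_hypergeo (arith_params Q N @ arith_params S s)
      (arith_params Q s @ replicate (N - 1) 1) (of_nat (N ^ N))) j =
    pochhammer Q (N * j) * pochhammer S (s * j) / (pochhammer Q (s * j) * fact j ^ N)"
proof -
  have "fact j ^ N = (fact j ^ (N - 1) * fact j :: 'a)"
    using assms by (simp flip: power_Suc2)
  \<comment> \<open>At \<open>s = 0\<close> this is \<open>0 ^ 0 = 1\<close>.\<close>
  moreover have "of_nat s ^ (s * j) \<noteq> (0 :: 'a)"
    by (cases "s = 0") simp_all
  moreover have "of_nat N ^ (N * j) \<noteq> (0 :: 'a)"
    using assms by simp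
  ultimately show ?thesis
    using assms by (simp add: foldl_mult_eq_prod_list prod_list_pochhammer_arith_params
        power_mult pochhammer_fact[symmetric] del: power_eq_0_iff)
qed

section \<open>Diagonal exponent vectors\<close>

text \<open>Only an inclusion: at \<open>j = 0\<close> the vector is zero and its support
  empty.\<close>

lemma keys_sum_single_subset:
  "Poly_Mapping.keys (\<Sum>i\<in>A. Poly_Mapping.single i (j::nat)) \<subseteq> A"
  by (induction A rule: infinite_finite_induct) (auto simp: keys_add_nat)

lemma monom_degree_sum_single: "monom_degree (\<Sum>i\<in>A. Poly_Mapping.single i j) = card A * j"
  by (induction A rule: infinite_finite_induct) (simp_all add: monom_degree_add)

lemma monom_fact_sum_single:
  "monom_fact (\<Sum>i\<in>A. Poly_Mapping.single i j) = (fact j ^ card A :: 'a::field_char_0)"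
proof (induction A rule: infinite_finite_induct)
  case (insert x A)
  have "Poly_Mapping.keys (Poly_Mapping.single x j)
      \<inter> Poly_Mapping.keys (\<Sum>i\<in>A. Poly_Mapping.single i j) = {}"
    using insert.hyps keys_sum_single_subset[of j A] by auto
  then have "monom_fact (Poly_Mapping.single x j + (\<Sum>i\<in>A. Poly_Mapping.single i j))
      = monom_fact (Poly_Mapping.single x j) * (fact j ^ card A :: 'a)"
    using insert.IH by (simp add: monom_fact_add_disjoint)
  moreover have "monom_fact (Poly_Mapping.single x j) = (fact j :: 'a)"
    by (simp add: monom_fact_def)
  ultimately show ?case using insert.hyps by simp
qed simp_all

theorem theorem1:
  fixes R S Q :: rat and n N s :: nat
  assumes "S \<noteq> 0" and "n \<le> N" and "1 \<le> N"
    and "s = N - n" and "Q = S - R"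
    and "hypergeo_defined (arith_params Q s @ replicate (N - 1) 1)"
  shows "fps_hypergeo (arith_params Q N @ arith_params S s)
           (arith_params Q s @ replicate (N - 1) 1) (of_nat (N ^ N)) =
         mfps_diag N
           (mfps_powr (1 - (\<Sum>i=1..n. mfps_var i)) R / mfps_powr (1 - (\<Sum>i=1..N. mfps_var i)) S)"
proof (rule fps_ext)
  fix j :: nat
  let ?q = "mfps_powr (1 - (\<Sum>i=1..n. mfps_var i)) R / mfps_powr (1 - (\<Sum>i=1..N. mfps_var i)) S"
  let ?e = "\<lambda>A. \<Sum>i\<in>A. Poly_Mapping.single i j"
  have split: "{1..N} = {1..n} \<union> {n+1..N}" "{1..n} \<inter> {n+1..N} = {}"
    using assms(2) by auto
  have N: "N = s + n" using assms by simp
  \<comment> \<open>The diagonal exponent splits into the variables of the numerator, of degree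
    \<open>n * j\<close>, and the remaining ones, of degree \<open>s * j\<close>.\<close>
  have "fps_nth (mfps_diag N ?q) j = mfps_nth ?q (?e {1..n} + ?e {n+1..N})"
    unfolding mfps_diag_def fps_nth_Abs_fps using split by (simp add: sum.union_disjoint)
  also have "\<dots> = pochhammer S (monom_degree (?e {n+1..N}))
      * pochhammer (S - R + of_nat (monom_degree (?e {n+1..N}))) (monom_degree (?e {1..n}))
      / (monom_fact (?e {1..n}) * monom_fact (?e {n+1..N}))"
  proof (rule mfps_nth_powr_quotient)
    show "Poly_Mapping.keys (?e {n+1..N}) \<subseteq> {1..N} - {1..n}"
      using keys_sum_single_subset[of j "{n+1..N}"] by force
  qed (use assms(2) keys_sum_single_subset[of j "{1..n}"] in auto)
  also have "\<dots> = pochhammer S (s * j) * pochhammer (Q + of_nat (s * j)) (n * j) / fact j ^ N"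
    by (simp add: monom_degree_sum_single monom_fact_sum_single N assms(5) power_add mult_ac)
  \<comment> \<open>Since \<open>N = s + n\<close>,
    \<open>(Q)_(N j) = (Q)_(s j) * (Q + s j)_(n j)\<close>; definedness of the lower parameters
    permits division by \<open>(Q)_(s j)\<close>.\<close>
  also have "\<dots> = pochhammer Q (N * j) * pochhammer S (s * j) / (pochhammer Q (s * j) * fact j ^ N)"
    using pochhammer_nonzero_if_hypergeo_defined[OF assms(6), of j]
    by (simp add: N add_mult_distrib pochhammer_product')
  also have "\<dots> = fps_nth (fps_hypergeo (arith_params Q N @ arith_params S s)
           (arith_params Q s @ replicate (N - 1) 1) (of_nat (N ^ N))) j"
    by (rule fps_hypergeo_arith_params_nth[OF assms(3), symmetric])
  finally show "fps_nth (fps_hypergeo (arith_params Q N @ arith_params S s)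
           (arith_params Q s @ replicate (N - 1) 1) (of_nat (N ^ N))) j = fps_nth (mfps_diag N ?q) j" ..
qed

end
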